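(* For every graph $\mathcal{G}$ with vertex set $\{1,\dots,p\}$, both $\gamma(\mathcal{G}) \leq \rho(\mathcal{G})$ and $\gamma^*(\mathcal{G}) \leq \rho^*(\mathcal{G})$.
   Context: Graphs are finite, simple and undirected, $\mathcal{G}=(V,E)$ with $V=\{1,\dots,p\}$, $p\ge 1$, and $E\subseteq\{\{i,j\}: i,j\in V,\ i\neq j\}$. $\mathcal{S}$ is the space of real symmetric $p\times p$ matrices. $\mathcal{S}_{\mathcal{G}}=\{\Omega\in\mathcal{S}: \Omega_{ij}=0 \text{ for all } i\neq j \text{ with } \{i,j\}\notin E\}$ (diagonal entries are unconstrained). $\mathcal{D}_{\mathcal{G}}^{++}=\{\Omega\in\mathcal{S}_{\mathcal{G}}:\Omega_{ii}>0\ \forall i\}$, and $\mathbb{P}_{\mathcal{G}}^{++}=\{\Omega\in\mathcal{S}_{\mathcal{G}}:\Omega\succ0\}$. For a positive semidefinite $A\in\mathcal{S}$, the CONCORD objective is $C_A(\Omega)=-2\sum_{i=1}^p\log\Omega_{ii}+\sum_{i=1}^p\Omega_{\cdot i}^{\top}A\,\Omega_{\cdot i}$ and the CONSPACE objective is $H_A(\Omega)=-2\sum_{i=1}^p\log\Omega_{ii}+\sum_{i=1}^p\Omega_{ii}^{-1}\Omega_{\cdot i}^{\top}A\,\Omega_{\cdot i}$ for $\Omega\in\mathcal{D}_{\mathcal{G}}^{++}$ with columns $\Omega_{\cdot i}$; the Gaussian objective is $G_A(\Omega)=-\log\det\Omega+\operatorname{tr}(A\Omega)$ for $\Omega\in\mathbb{P}_{\mathcal{G}}^{++}$.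 A symmetric matrix $A$ is in general position if every $q\times q$ principal submatrix of $A$ has rank $\min\{q,\operatorname{rank}(A)\}$. "For almost every $A\succeq 0$ with $\operatorname{rank}(A)\ge\rho$" means: for each integer $r$ with $\rho\le r\le p$, the property holds for $A=X^\top X$ for Lebesgue-almost every $X\in\mathbb{R}^{r\times p}$. Weak pseudo-likelihood rank $\rho(\mathcal{G})$: the smallest $\rho\in\mathbb{N}$ such that a unique minimizer of $C_A$ exists on $\mathcal{D}_{\mathcal{G}}^{++}$ for almost every $A\succeq 0$ with $\operatorname{rank}(A)\ge\rho$. Strong pseudo-likelihood rank $\rho^*(\mathcal{G})$: the smallest $\rho^*\in\mathbb{N}$ such that a unique minimizer of $C_A$ exists on $\mathcal{D}_{\mathcal{G}}^{++}$ for every $A\succeq0$ in general position with $\operatorname{rank}(A)\ge\rho^*$. (Using $H_A$ in place of $C_A$ gives the same numbers.) Weak Gaussian rank $\gamma(\mathcal{G})$: the smallest $\gamma\in\mathbb{N}$ such that a unique minimizer of $G_A$ exists on $\mathbb{P}_{\mathcal{G}}^{++}$ for almost every $A\succeq0$ with $\operatorname{rank}(A)\ge\gamma$. Strong Gaussian rank $\gamma^*(\mathcal{G})$: the smallest $\gamma^*\in\mathbb{N}$ such that a unique minimizer of $G_A$ exists on $\mathbb{P}_{\mathcal{G}}^{++}$ for every $A\succeq0$ in general position with $\operatorname{rank}(A)\ge\gamma^*$. *)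

theory Defs
  imports "HOL-Analysis.Analysis"
begin

text \<open>
  The vertex set is the finite type \<open>'n\<close>, so \<open>p = CARD('n) \<ge> 1\<close>, and a graph is given by its set of
  edges, each of them a two-element set of vertices.
\<close>

definition simple_graph :: "'n::finite set set \<Rightarrow> bool" where
  "simple_graph E \<longleftrightarrow> E \<subseteq> {{i, j} | i j. i \<noteq> j}"

definition symmetric_mat :: "real^'n^'n \<Rightarrow> bool" where
  "symmetric_mat A \<longleftrightarrow> transpose A = A"

definition psd :: "real^'n^'n \<Rightarrow> bool" where
  "psd A \<longleftrightarrow> symmetric_mat A \<and> (\<forall>x. 0 \<le> x \<bullet> (A *v x))"

definition pos_def :: "real^'n^'n \<Rightarrow> bool" where
  "pos_def A \<longleftrightarrow> symmetric_mat A \<and> (\<forall>x. x \<noteq> 0 \<longrightarrow> 0 < x \<bullet> (A *v x))"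

definition S_graph :: "'n::finite set set \<Rightarrow> (real^'n^'n) set" where
  "S_graph E = {\<Omega>. symmetric_mat \<Omega> \<and> (\<forall>i j. i \<noteq> j \<and> {i, j} \<notin> E \<longrightarrow> \<Omega> $ i $ j = 0)}"

definition D_graph :: "'n::finite set set \<Rightarrow> (real^'n^'n) set" where
  "D_graph E = {\<Omega> \<in> S_graph E. \<forall>i. \<Omega> $ i $ i > 0}"

definition P_graph :: "'n::finite set set \<Rightarrow> (real^'n^'n) set" where
  "P_graph E = {\<Omega> \<in> S_graph E. pos_def \<Omega>}"

definition concord :: "real^'n^'n \<Rightarrow> real^'n^'n \<Rightarrow> real" where
  "concord A \<Omega> = - 2 * (\<Sum>i\<in>UNIV. ln (\<Omega> $ i $ i))
     + (\<Sum>i\<in>UNIV. column i \<Omega> \<bullet> (A *v column i \<Omega>))"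

definition gaussian :: "real^'n^'n \<Rightarrow> real^'n^'n \<Rightarrow> real" where
  "gaussian A \<Omega> = - ln (det \<Omega>) + trace (A ** \<Omega>)"

definition has_unique_minimizer :: "('a \<Rightarrow> real) \<Rightarrow> 'a set \<Rightarrow> bool" where
  "has_unique_minimizer f S \<longleftrightarrow> (\<exists>!x. is_arg_min f (\<lambda>y. y \<in> S) x)"

text \<open>
  Matrix sizes are types, so the principal submatrix on the index set \<open>S\<close> is represented with its
  rows and columns outside \<open>S\<close> filled up with zeros, which does not change its rank. The lemma
  \<open>rank_principal_submatrix\<close> below confirms this: it compares with the genuine \<open>q \<times> q\<close> submatrix,
  indexed by any type \<open>'q\<close> that enumerates \<open>S\<close>.
\<close>

definition principal_submatrix :: "real^'n^'n \<Rightarrow> 'n set \<Rightarrow> real^'n^'n" where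
  "principal_submatrix A S = (\<chi> i j. if i \<in> S \<and> j \<in> S then A $ i $ j else 0)"

lemma rank_principal_submatrix:
  fixes A :: "real^'n^'n" and f :: "'q::finite \<Rightarrow> 'n::finite"
  assumes "inj f"
  shows "rank (\<chi> i j. A $ f i $ f j :: real^'q^'q) = rank (principal_submatrix A (range f))"
proof -
  let ?B = "\<chi> i j. A $ f i $ f j :: real^'q^'q"
  let ?P = "principal_submatrix A (range f)"
  define g :: "real^'q \<Rightarrow> real^'n"
    where "g x = (\<chi> j. if j \<in> range f then x $ inv f j else 0)" for x
  have lin: "linear g"
    by (rule linearI) (auto simp: g_def vec_eq_iff)
  have gf: "g x $ f j = x $ j" for x j
    using assms by (simp add: g_def)
  have "inj g"
    by (rule injI) (metis gf vec_eq_iff)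
  have row_f: "row (f i) ?P = g (row i ?B)" for i
    using assms by (auto simp: row_def g_def principal_submatrix_def vec_eq_iff)
  have row_0: "row i ?P = 0" if "i \<notin> range f" for i
    using that by (simp add: row_def principal_submatrix_def vec_eq_iff)
  have "rows ?P - {0} = g ` rows ?B - {0}"
  proof (intro equalityI subsetI)
    fix v assume v: "v \<in> rows ?P - {0}"
    then obtain i where i: "v = row i ?P"
      by (auto simp: rows_def)
    with v row_0 obtain k where "i = f k"
      by blast
    with i row_f have "v = g (row k ?B)"
      by simp
    with v show "v \<in> g ` rows ?B - {0}"
      by (auto simp: rows_def)
  next
    fix v assume v: "v \<in> g ` rows ?B - {0}"
    then obtain k where "v = g (row k ?B)"
      by (auto simp: rows_def)
    with row_f have "v = row (f k) ?P"
      by simp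
    with v show "v \<in> rows ?P - {0}"
      by (auto simp: rows_def)
  qed
  then have "span (rows ?P) = span (g ` rows ?B)"
    by (metis span_delete_0)
  then have "dim (rows ?P) = dim (g ` rows ?B)"
    by (metis dim_span)
  also have "\<dots> = dim (rows ?B)"
    using lin \<open>inj g\<close> by (rule dim_image_eq[OF _ inj_on_subset]) auto
  finally show ?thesis
    by (simp add: row_rank_def)
qed

definition general_position :: "real^'n^'n \<Rightarrow> bool" where
  "general_position A \<longleftrightarrow> symmetric_mat A
     \<and> (\<forall>S. rank (principal_submatrix A S) = min (card S) (rank A))"

text \<open>
  The number \<open>r\<close> of rows of \<open>X \<in> \<real>\<^sup>r\<^sup>\<times>\<^sup>p\<close> is not a type, so \<open>X\<close> is a function on
  \<open>{..<r} \<times> UNIV\<close>, and the Lebesgue measure is the product of the Lebesgue measures of its entries.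
  Completing the product measure would not change \<open>AE\<close>.
\<close>

definition lebesgue_rect :: "nat \<Rightarrow> (nat \<times> 'n::finite \<Rightarrow> real) measure" where
  "lebesgue_rect r = Pi\<^sub>M ({..<r} \<times> UNIV) (\<lambda>_. lborel)"

text \<open>The matrix \<open>X\<^sup>T X\<close>.\<close>

definition gram :: "nat \<Rightarrow> (nat \<times> 'n::finite \<Rightarrow> real) \<Rightarrow> real^'n^'n" where
  "gram r X = (\<chi> i j. \<Sum>k<r. X (k, i) * X (k, j))"

definition almost_every_psd :: "nat \<Rightarrow> (real^'n::finite^'n \<Rightarrow> bool) \<Rightarrow> bool" where
  "almost_every_psd \<rho> Q \<longleftrightarrow> (\<forall>r\<in>{\<rho>..CARD('n)}. AE X in lebesgue_rect r. Q (gram r X))"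

definition every_general_psd :: "nat \<Rightarrow> (real^'n::finite^'n \<Rightarrow> bool) \<Rightarrow> bool" where
  "every_general_psd \<rho> Q \<longleftrightarrow> (\<forall>A. psd A \<and> general_position A \<and> rank A \<ge> \<rho> \<longrightarrow> Q A)"

text \<open>
  The two conditions hold vacuously for \<open>\<rho> > CARD('n)\<close>, so the minima below are attained.
\<close>

lemma almost_every_psd_vacuous: "almost_every_psd (Suc CARD('n)) (Q :: real^'n::finite^'n \<Rightarrow> bool)"
  by (simp add: almost_every_psd_def)

lemma every_general_psd_vacuous: "every_general_psd (Suc CARD('n)) (Q :: real^'n::finite^'n \<Rightarrow> bool)"
proof -
  have "rank A \<le> CARD('n)" for A :: "real^'n^'n"
    using rank_bound[of A] by simp
  then show ?thesis
    unfolding every_general_psd_def by (metis not_less_eq_eq)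
qed

definition weak_pl_rank :: "'n::finite set set \<Rightarrow> nat" where
  "weak_pl_rank E =
     (LEAST \<rho>. almost_every_psd \<rho> (\<lambda>A. has_unique_minimizer (concord A) (D_graph E)))"

definition strong_pl_rank :: "'n::finite set set \<Rightarrow> nat" where
  "strong_pl_rank E =
     (LEAST \<rho>. every_general_psd \<rho> (\<lambda>A. has_unique_minimizer (concord A) (D_graph E)))"

definition weak_gaussian_rank :: "'n::finite set set \<Rightarrow> nat" where
  "weak_gaussian_rank E =
     (LEAST \<gamma>. almost_every_psd \<gamma> (\<lambda>A. has_unique_minimizer (gaussian A) (P_graph E)))"

definition strong_gaussian_rank :: "'n::finite set set \<Rightarrow> nat" where
  "strong_gaussian_rank E =
     (LEAST \<gamma>. every_general_psd \<gamma> (\<lambda>A. has_unique_minimizer (gaussian A) (P_graph E)))"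

end

theory Submission
  imports Defs
begin

text \<open>
  The implication holds for each single positive semidefinite \<open>A\<close>. If the CONCORD objective has a
  unique minimizer, then no nonzero \<open>D \<in> S_graph E\<close> with nonnegative diagonal satisfies \<open>A D = 0\<close>,
  since it could be added to the minimizer. A positive semidefinite \<open>D\<close> with \<open>tr (A D) = 0\<close> has both
  properties, so \<open>tr (A W) \<ge> c \<parallel>W\<parallel>\<close> for some \<open>c > 0\<close> on the positive semidefinite part of
  \<open>S_graph E\<close>. Hence the Gaussian objective is coercive and attains its minimum, which is unique
  by strict concavity of \<open>ln det\<close>.
\<close>

section \<open>Positive semidefinite matrices\<close>

definition outer :: "real^'n \<Rightarrow> real^'n^'n" where
  "outer v = (\<chi> i j. v $ i * v $ j)"

lemma outer_mult_vec: "outer v *v x = (v \<bullet> x) *\<^sub>R v"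
  by (simp add: vec_eq_iff outer_def matrix_vector_mult_def inner_vec_def sum_distrib_left
      sum_distrib_right ac_simps)

lemma symmetric_mat_nth: "symmetric_mat A \<longleftrightarrow> (\<forall>i j. A $ i $ j = A $ j $ i)"
  by (auto simp: symmetric_mat_def vec_eq_iff transpose_def)

lemma symmetric_mat_inner:
  assumes "symmetric_mat A"
  shows "(A *v x) \<bullet> y = x \<bullet> (A *v y)"
  by (metis assms dot_lmul_matrix symmetric_mat_def vector_transpose_matrix)

lemma inner_axis_mult_axis: "axis i 1 \<bullet> (A *v axis i 1) = (A :: real^'n^'n) $ i $ i"
  by (simp add: inner_axis' matrix_vector_mult_basis column_def)

lemma psd_diag_nonneg: "psd A \<Longrightarrow> 0 \<le> A $ i $ i"
  by (metis psd_def inner_axis_mult_axis)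

lemma psd_outer: "psd (outer v)"
  by (simp add: psd_def symmetric_mat_nth outer_mult_vec)
    (simp add: outer_def inner_commute mult.commute)

lemma psd_add: "psd A \<Longrightarrow> psd B \<Longrightarrow> psd (A + B)"
  by (simp add: psd_def symmetric_mat_nth matrix_vector_mult_add_rdistrib inner_add_right)

text \<open>A step from \<open>x\<close> in the direction \<open>- A x\<close> lowers the quadratic
  form to first order. Since the form starts at 0, it would become negative unless
  \<open>A x\<close> vanishes.\<close>

lemma psd_mult_eq_0:
  assumes "psd A" "x \<bullet> (A *v x) = 0"
  shows "A *v x = 0"
proof (rule ccontr)
  assume nz: "A *v x \<noteq> 0"
  define y n q where "y = A *v x" and "n = y \<bullet> y" and "q = y \<bullet> (A *v y)"
  have sym: "symmetric_mat A" using assms psd_def by blast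
  have n: "n > 0" using nz by (simp add: n_def y_def)
  have q: "q \<ge> 0" using assms by (simp add: psd_def q_def)
  have xAy: "x \<bullet> (A *v y) = n"
    using symmetric_mat_inner[OF sym, of x y] by (simp add: n_def y_def)
  \<comment> \<open>The summand 1 keeps the denominator positive even if \<open>q = 0\<close>, and
    \<open>t * q = n - t\<close> turns the value of the form into
    \<open>t * (- n - t)\<close>.\<close>
  define t where "t = n / (1 + q)"
  have t: "t > 0" "t * (1 + q) = n" using n q by (simp_all add: t_def)
  have "0 \<le> (x - t *\<^sub>R y) \<bullet> (A *v (x - t *\<^sub>R y))"
    using assms psd_def by blast
  also have "\<dots> = - 2 * t * n + t * (t * q)"
    using xAy assms(2)
    by (simp add: algebra_simps matrix_vector_mult_diff_distrib matrix_vector_mult_scaleR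
        flip: y_def n_def q_def)
  also have "\<dots> = t * (- n - t)"
    unfolding t(2)[symmetric] by (simp add: algebra_simps)
  finally show False using t(1) n by (simp add: zero_le_mult_iff)
qed

lemma psd_diag_eq_0:
  assumes "psd A" "\<And>i. A $ i $ i = 0"
  shows "A = 0"
proof -
  have "column i A = 0" for i
    using psd_mult_eq_0[OF assms(1), of "axis i 1"] assms(2) inner_axis_mult_axis[of i A]
    by (simp add: matrix_vector_mult_basis)
  then show ?thesis by (simp add: vec_eq_iff column_def)
qed

text \<open>One step of symmetric Gaussian elimination.\<close>

lemma psd_eliminate:
  assumes "psd A" "A $ i $ i \<noteq> 0"
  obtains B v where "psd B" "A = B + outer v" "B $ i $ i = 0"
proof -
  define d where "d = A $ i $ i"
  have d: "d > 0" using psd_diag_nonneg[OF assms(1), of i] assms(2) by (simp add: d_def)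
  have sym: "symmetric_mat A" using assms psd_def by blast
  define a where "a = A *v axis i 1"
  define v where "v = (1 / sqrt d) *\<^sub>R a"
  define B where "B = A - outer v"
  have a_i: "a $ i = d" by (simp add: a_def d_def matrix_vector_mult_basis column_def)
  have "psd B"
    unfolding psd_def
  proof (intro conjI allI)
    show "symmetric_mat B" using sym by (simp add: symmetric_mat_nth B_def outer_def)
    fix x
    \<comment> \<open>This \<open>s\<close> minimizes the form of \<open>A\<close> along the line
      \<open>x - s e_i\<close>. The minimum is exactly the form of \<open>B\<close> at
      \<open>x\<close>, a Schur complement.\<close>
    define s where "s = (x \<bullet> a) / d"
    have ax: "axis i 1 \<bullet> (A *v x) = x \<bullet> a"
      using symmetric_mat_inner[OF sym, of "axis i 1" x] by (simp add: a_def inner_commute)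
    have "0 \<le> (x - s *\<^sub>R axis i 1) \<bullet> (A *v (x - s *\<^sub>R axis i 1))"
      using assms psd_def by blast
    also have "\<dots> = x \<bullet> (A *v x) - 2 * s * (x \<bullet> a) + s * s * d"
      using ax inner_axis_mult_axis[of i A]
      by (simp add: algebra_simps matrix_vector_mult_diff_distrib matrix_vector_mult_scaleR
          flip: a_def d_def)
    also have "\<dots> = x \<bullet> (A *v x) - (x \<bullet> a)\<^sup>2 / d"
      using d by (simp add: s_def power2_eq_square)
    also have "\<dots> = x \<bullet> (B *v x)"
      using d by (simp add: B_def matrix_vector_mult_diff_rdistrib outer_mult_vec inner_diff_right
          v_def inner_commute power2_eq_square)
    finally show "0 \<le> x \<bullet> (B *v x)" .
  qed
  moreover have "A = B + outer v" by (simp add: B_def)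
  moreover have "B $ i $ i = 0"
    using d a_i by (simp add: B_def outer_def v_def flip: d_def)
  ultimately show ?thesis using that by blast
qed

text \<open>Each elimination clears one diagonal entry, and entries that are already zero stay zero
  because both summands have nonnegative diagonals. So the number of nonzero diagonal entries drops.
  The rule stands in for a spectral decomposition.\<close>

lemma psd_induct [consumes 1, case_names zero outer]:
  fixes A :: "real^'n::finite^'n"
  assumes "psd A" "P 0" "\<And>A v. psd A \<Longrightarrow> P A \<Longrightarrow> P (A + outer v)"
  shows "P A"
  using assms(1)
proof (induction "card {i. A $ i $ i \<noteq> 0}" arbitrary: A rule: less_induct)
  case less
  show ?case
  proof (cases "\<forall>i. A $ i $ i = 0")
    case True
    then show ?thesis using psd_diag_eq_0[OF less.prems] assms(2) by simp
  next
    case False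
    then obtain i where i: "A $ i $ i \<noteq> 0" by blast
    obtain B v where B: "psd B" "A = B + outer v" "B $ i $ i = 0"
      using psd_eliminate[OF less.prems i] .
    have "B $ j $ j = 0" if "A $ j $ j = 0" for j
    proof -
      have "B $ j $ j + v $ j * v $ j = 0" using that B(2) by (simp add: outer_def)
      then show ?thesis using psd_diag_nonneg[OF B(1), of j] zero_le_square[of "v $ j"] by linarith
    qed
    then have "{j. B $ j $ j \<noteq> 0} \<subset> {j. A $ j $ j \<noteq> 0}" using i B(3) by blast
    then have "card {j. B $ j $ j \<noteq> 0} < card {j. A $ j $ j \<noteq> 0}"
      by (simp add: psubset_card_mono)
    then show ?thesis using less.hyps B assms(3) by blast
  qed
qed

section \<open>The trace pairing of positive semidefinite matrices\<close>

lemma matrix_mult_add_left: "(A + B) ** C = A ** C + B ** C"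
  for A B :: "real^'n^'m" and C :: "real^'k^'n"
  by (simp add: vec_eq_iff matrix_matrix_mult_def algebra_simps sum.distrib)

lemma matrix_mult_diff_left: "(A - B) ** C = A ** C - B ** C"
  for A B :: "real^'n^'m" and C :: "real^'k^'n"
  by (simp add: vec_eq_iff matrix_matrix_mult_def algebra_simps sum_subtractf)

lemma matrix_mult_diff_right: "C ** (A - B) = C ** A - C ** B"
  for A B :: "real^'n^'m" and C :: "real^'m^'k"
  by (simp add: vec_eq_iff matrix_matrix_mult_def algebra_simps sum_subtractf)

lemma trace_outer_mult: "trace (outer v ** W) = v \<bullet> (W *v v)"
proof -
  have "trace (outer v ** W) = trace (W ** outer v)"
    by (rule trace_mul_sym)
  also have "\<dots> = v \<bullet> (W *v v)"
    by (simp add: trace_def matrix_matrix_mult_def matrix_vector_mult_def outer_def inner_vec_def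
        sum_distrib_left ac_simps)
  finally show ?thesis .
qed

text \<open>Written with \<open>A\<close> as a sum of outer products, the trace is a sum of
  nonnegative terms \<open>v \<bullet> (W *v v)\<close>. If it is 0, every term is, so
  \<open>W\<close> kills every \<open>v\<close>. Nonnegativity is part of the induction because it
  is what lets a zero sum be split.\<close>

lemma trace_mult_psd:
  assumes "psd A" "psd W"
  shows "0 \<le> trace (A ** W) \<and> (trace (A ** W) = 0 \<longrightarrow> W ** A = 0)"
  using assms(1)
proof (induction rule: psd_induct)
  case zero
  then show ?case by (simp add: trace_def matrix_matrix_mult_def vec_eq_iff)
next
  case (outer A v)
  have tr: "trace ((A + outer v) ** W) = trace (A ** W) + v \<bullet> (W *v v)"
    by (simp add: matrix_mult_add_left trace_add trace_outer_mult)
  have v: "0 \<le> v \<bullet> (W *v v)" using assms(2) psd_def by blast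
  have "W ** (A + outer v) = 0" if "trace ((A + outer v) ** W) = 0"
  proof -
    have "trace (A ** W) = 0" "v \<bullet> (W *v v) = 0" using that tr v outer.IH by linarith+
    then have "W ** A = 0" "W *v v = 0" using outer.IH psd_mult_eq_0[OF assms(2)] by auto
    moreover have "(W ** outer v) *v x = 0" for x
      using \<open>W *v v = 0\<close>
      by (simp add: outer_mult_vec matrix_vector_mult_scaleR flip: matrix_vector_mul_assoc)
    then have "W ** outer v = 0" by (subst matrix_eq) simp
    ultimately show ?thesis by (simp add: matrix_add_ldistrib)
  qed
  then show ?case using tr v outer.IH by simp
qed

lemma trace_mult_psd_eq_0:
  assumes "psd A" "psd W" "trace (A ** W) = 0"
  shows "A ** W = 0"
  using trace_mult_psd[OF assms(2,1)] assms(3) trace_mul_sym[of W A] by simp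

section \<open>Determinants of positive definite matrices\<close>

lemma pos_def_imp_psd:
  assumes "pos_def A"
  shows "psd A"
  unfolding psd_def
proof (intro conjI allI)
  show "symmetric_mat A" using assms by (simp add: pos_def_def)
  show "0 \<le> x \<bullet> (A *v x)" for x
    using assms by (cases "x = 0") (auto simp: pos_def_def less_imp_le)
qed

lemma pos_def_det_nonzero:
  assumes "pos_def A"
  shows "det A \<noteq> 0"
proof -
  have "x = 0" if "A *v x = 0" for x
    using assms that unfolding pos_def_def by force
  then show ?thesis
    by (metis invertible_det_nz invertible_left_inverse matrix_left_invertible_ker)
qed

lemma psd_det_nonzero_imp_pos_def:
  assumes "psd A" "det A \<noteq> 0"
  shows "pos_def A"
  unfolding pos_def_def
proof (intro conjI allI impI)
  show "symmetric_mat A" using assms psd_def by blast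
  fix x :: "real^'a" assume x: "x \<noteq> 0"
  have "A *v x \<noteq> 0"
    using assms(2) x
    by (metis invertible_det_nz invertible_left_inverse matrix_left_invertible_ker)
  then show "0 < x \<bullet> (A *v x)"
    using psd_mult_eq_0[OF assms(1)] assms(1) unfolding psd_def by (metis less_eq_real_def)
qed

lemma pos_def_mat_1: "pos_def (mat 1)"
  by (simp add: pos_def_def symmetric_mat_def)

lemma pos_def_add_psd: "pos_def A \<Longrightarrow> psd B \<Longrightarrow> pos_def (A + B)"
  unfolding pos_def_def psd_def
  by (auto simp: symmetric_mat_nth matrix_vector_mult_add_rdistrib inner_add_right
      intro: add_pos_nonneg)

lemma pos_def_scaleR: "pos_def A \<Longrightarrow> 0 < c \<Longrightarrow> pos_def (c *\<^sub>R A)"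
  unfolding pos_def_def
  by (auto simp: symmetric_mat_nth simp flip: scaleR_matrix_vector_assoc)

lemma psd_scaleR: "psd A \<Longrightarrow> 0 \<le> c \<Longrightarrow> psd (c *\<^sub>R A)"
  unfolding psd_def
  by (auto simp: symmetric_mat_nth simp flip: scaleR_matrix_vector_assoc)

lemma continuous_on_det:
  assumes "continuous_on S f"
  shows "continuous_on S (\<lambda>x. det (f x :: real^'n^'n))"
  unfolding det_def by (intro continuous_intros assms)

text \<open>The segment from the identity to \<open>A\<close> consists of invertible matrices.\<close>

lemma pos_def_det_pos:
  assumes "pos_def A"
  shows "0 < det A"
proof (rule ccontr)
  assume neg: "\<not> 0 < det A"
  define f where "f t = det ((1 - t) *\<^sub>R mat 1 + t *\<^sub>R A)" for t :: real
  have "continuous_on {0..1} f"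
    unfolding f_def by (intro continuous_on_det continuous_intros)
  moreover have "f 1 \<le> 0" "0 \<le> f 0" using neg by (simp_all add: f_def)
  ultimately obtain t where t: "0 \<le> t" "t \<le> 1" "f t = 0"
    using IVT2'[of f 1 0 0] by auto
  have "pos_def ((1 - t) *\<^sub>R mat 1 + t *\<^sub>R A)"
  \<comment> \<open>For \<open>t < 1\<close> the identity has positive weight and makes the sum
    definite; at \<open>t = 1\<close> only \<open>A\<close> is left.\<close>
  proof (cases "t = 1")
    case False
    then show ?thesis
      using t assms by (intro pos_def_add_psd pos_def_scaleR psd_scaleR pos_def_mat_1 pos_def_imp_psd) auto
  qed (use assms in simp)
  then show False using pos_def_det_nonzero t(3) f_def by metis
qed

lemma pos_def_solve:
  assumes "pos_def A"
  obtains x where "A *v x = b"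
  using cramer[OF pos_def_det_nonzero[OF assms]] that by blast

text \<open>Only column \<open>k\<close> changes, and the new column is \<open>A y\<close> with
  \<open>y = e_k + c x\<close>, where \<open>x\<close> solves \<open>A x = e_k\<close>. By Cramer's
  rule the determinant is multiplied by \<open>y $ k = 1 + c * x $ k\<close>, and
  \<open>x $ k\<close> is the form of \<open>A\<close> at \<open>x\<close>.\<close>

lemma det_add_axis:
  assumes "pos_def A" "0 < c"
  shows "det A < det (A + c *\<^sub>R outer (axis k 1))"
proof -
  obtain x where x: "A *v x = axis k 1" using pos_def_solve[OF assms(1)] .
  have "x \<noteq> 0" using x by (metis axis_eq_0_iff matrix_vector_mult_0_right zero_neq_one)
  then have "0 < x \<bullet> (A *v x)" using assms(1) pos_def_def by blast
  then have xk: "0 < x $ k" by (simp add: x inner_axis)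
  define y where "y = axis k 1 + c *\<^sub>R x"
  have y: "A *v y = column k A + c *\<^sub>R axis k 1"
    by (simp add: y_def matrix_vector_right_distrib matrix_vector_mult_scaleR x
        matrix_vector_mult_basis)
  have "A + c *\<^sub>R outer (axis k 1) = (\<chi> i j. if j = k then (A *v y) $ i else A $ i $ j)"
    by (simp add: y vec_eq_iff outer_def column_def axis_def)
  then have "det (A + c *\<^sub>R outer (axis k 1)) = y $ k * det A"
    by (simp add: cramer_lemma)
  also have "\<dots> = det A + c * x $ k * det A"
    by (simp add: y_def algebra_simps)
  finally show ?thesis
    using xk assms(2) pos_def_det_pos[OF assms(1)] by simp
qed

lemma outer_mult_right: "outer (Q *v w) = Q ** outer w ** transpose Q"
proof -
  have "w \<bullet> (transpose Q *v x) = (Q *v w) \<bullet> x" for x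
    by (metis dot_lmul_matrix vector_transpose_matrix transpose_transpose)
  then show ?thesis
    by (subst matrix_eq)
      (simp add: outer_mult_vec matrix_vector_mult_scaleR flip: matrix_vector_mul_assoc)
qed

lemma pos_def_congruence:
  fixes A Q :: "real^'n^'n"
  assumes "pos_def A" "invertible Q"
  shows "pos_def (transpose Q ** A ** Q)"
  unfolding pos_def_def
proof (intro conjI allI impI)
  show "symmetric_mat (transpose Q ** A ** Q)"
    using assms(1) by (simp add: pos_def_def symmetric_mat_def matrix_transpose_mul matrix_mul_assoc)
  fix x :: "real^'n" assume "x \<noteq> 0"
  then have "Q *v x \<noteq> 0"
    using assms(2) by (metis invertible_left_inverse matrix_left_invertible_ker)
  then have "0 < (Q *v x) \<bullet> (A *v (Q *v x))" using assms(1) pos_def_def by blast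
  also have "\<dots> = x \<bullet> (transpose Q *v (A *v (Q *v x)))"
    by (metis dot_lmul_matrix vector_transpose_matrix transpose_transpose)
  finally show "0 < x \<bullet> ((transpose Q ** A ** Q) *v x)"
    by (simp add: matrix_vector_mul_assoc matrix_mul_assoc)
qed

text \<open>An orthogonal change of basis moves \<open>v\<close> onto a coordinate axis. It
  preserves determinants and definiteness, so the axis case applies.\<close>

lemma det_add_outer:
  fixes A :: "real^'n::finite^'n"
  assumes "pos_def A" "v \<noteq> 0"
  shows "det A < det (A + outer v)"
proof -
  obtain k :: 'n and Q where Q: "orthogonal_matrix Q" "Q *v axis k 1 = v /\<^sub>R norm v"
  proof (rule orthogonal_matrix_exists_basis)
    show "norm (v /\<^sub>R norm v) = 1" using assms(2) by simp
  qed
  define c where "c = (norm v)\<^sup>2"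
  have c: "0 < c" using assms(2) by (simp add: c_def)
  have "outer v = c *\<^sub>R outer (v /\<^sub>R norm v)"
    using assms(2) by (simp add: outer_def vec_eq_iff c_def power2_eq_square field_simps)
  also have "\<dots> = c *\<^sub>R (Q ** outer (axis k 1) ** transpose Q)"
    by (simp add: outer_mult_right flip: Q(2))
  also have "\<dots> = Q ** (c *\<^sub>R outer (axis k 1)) ** transpose Q"
    by (subst matrix_eq)
      (simp add: matrix_vector_mult_scaleR flip: matrix_vector_mul_assoc scaleR_matrix_vector_assoc)
  finally have out: "outer v = Q ** (c *\<^sub>R outer (axis k 1)) ** transpose Q" .
  define B where "B = transpose Q ** A ** Q"
  have QQ: "Q ** transpose Q = mat 1" using Q(1) by (simp add: orthogonal_matrix_def)
  have invQ: "invertible Q" using Q(1) by (auto simp: orthogonal_matrix_def invertible_def)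
  have "A = (Q ** transpose Q) ** A ** (Q ** transpose Q)" by (simp add: QQ)
  then have A: "A = Q ** B ** transpose Q" by (simp add: B_def matrix_mul_assoc)
  have conj: "det (Q ** M ** transpose Q) = det M" for M
  proof -
    have "det Q * det (transpose Q) = 1" using QQ by (metis det_mul det_I)
    then show ?thesis by (simp add: det_mul)
  qed
  have "det B < det (B + c *\<^sub>R outer (axis k 1))"
    using det_add_axis pos_def_congruence[OF assms(1) invQ] c B_def by blast
  moreover have "A + outer v = Q ** (B + c *\<^sub>R outer (axis k 1)) ** transpose Q"
    by (simp only: matrix_add_ldistrib matrix_mult_add_left flip: A out)
  ultimately show ?thesis using conj A by metis
qed

text \<open>Outer products are added one at a time, and each nonzero one strictly raises the
  determinant. The weak inequality is carried along because the part added so far may be 0.\<close>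

lemma det_add_psd:
  assumes "psd P" "pos_def A"
  shows "det A \<le> det (A + P) \<and> (P \<noteq> 0 \<longrightarrow> det A < det (A + P))"
  using assms(1)
proof (induction rule: psd_induct)
  case (outer P v)
  have pd: "pos_def (A + P)" using assms(2) outer.hyps pos_def_add_psd by blast
  show ?case
  proof (cases "v = 0")
    case True
    then have "outer v = 0" by (simp add: outer_def vec_eq_iff)
    then show ?thesis using outer.IH by simp
  next
    case False
    then show ?thesis
      using det_add_outer[OF pd False] outer.IH by (simp add: add.assoc)
  qed
qed simp

text \<open>The inverse \<open>B\<close> is symmetric and equals
  \<open>transpose B ** A ** B\<close>, so it is congruent to \<open>A\<close>.\<close>

lemma pos_def_inverse:
  assumes "pos_def A"
  obtains B where "A ** B = mat 1" "B ** A = mat 1" "pos_def B"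
proof -
  obtain B where B: "A ** B = mat 1" "B ** A = mat 1"
    using pos_def_det_nonzero[OF assms] by (metis invertible_det_nz invertible_def)
  have "invertible B" using B by (auto simp: invertible_def)
  have "symmetric_mat B"
    using B assms unfolding symmetric_mat_def pos_def_def
    by (metis matrix_mul_assoc matrix_mul_lid matrix_mul_rid matrix_transpose_mul transpose_mat)
  then have "transpose B ** A ** B = B"
    using B by (simp add: symmetric_mat_def)
  then show ?thesis
    using that B pos_def_congruence[OF assms \<open>invertible B\<close>] by metis
qed

text \<open>
  This is the strict concavity of \<open>ln det\<close> at the midpoint. It avoids eigenvalues: with
  \<open>\<Delta> = A - B\<close>, one has \<open>(A + B) A\<^sup>-\<^sup>1 (A + B) = 4 B + \<Delta> A\<^sup>-\<^sup>1 \<Delta>\<close>.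
\<close>

lemma det_midpoint:
  fixes A B :: "real^'n::finite^'n"
  assumes "pos_def A" "pos_def B" "A \<noteq> B"
  shows "det A * det B < (det ((1/2) *\<^sub>R (A + B)))\<^sup>2"
proof -
  obtain C where C: "A ** C = mat 1" "C ** A = mat 1" "pos_def C"
    using pos_def_inverse[OF assms(1)] .
  \<comment> \<open>With this half difference, \<open>M = A - D\<close> and
    \<open>B = A - D - D\<close>, so the identity becomes
    \<open>M ** C ** M = B + P\<close>.\<close>
  define M D where "M = (1/2) *\<^sub>R (A + B)" and "D = (1/2) *\<^sub>R (A - B)"
  define P where "P = D ** C ** D"
  have symD: "symmetric_mat D"
    using assms by (simp add: D_def pos_def_def symmetric_mat_nth)
  have P: "x \<bullet> (P *v x) = (D *v x) \<bullet> (C *v (D *v x))" for x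
    using symmetric_mat_inner[OF symD]
    by (simp add: P_def flip: matrix_vector_mul_assoc)
  have "symmetric_mat P"
    using symD C(3) by (simp add: P_def pos_def_def symmetric_mat_def matrix_transpose_mul matrix_mul_assoc)
  then have "psd P"
    using P pos_def_imp_psd[OF C(3)] by (simp add: psd_def)
  have "D \<noteq> 0" using assms(3) by (simp add: D_def)
  then obtain x where "D *v x \<noteq> 0" by (metis matrix_eq matrix_vector_mult_0)
  then have "x \<bullet> (P *v x) > 0" using P C(3) pos_def_def by metis
  then have "P \<noteq> 0" by auto
  then have "det B < det (B + P)" using det_add_psd[OF \<open>psd P\<close> assms(2)] by blast
  have MD: "M = A - D" by (simp add: M_def D_def vec_eq_iff field_simps)
  have BD: "B = A - D - D" by (simp add: D_def vec_eq_iff field_simps)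
  have "M ** C ** M = A ** C ** A - A ** C ** D - D ** C ** A + D ** C ** D"
    unfolding MD by (simp add: matrix_mult_diff_left matrix_mult_diff_right)
  also have "\<dots> = B + P"
    using C(1,2) by (simp add: BD P_def flip: matrix_mul_assoc)
  finally have "det M * det C * det M = det (B + P)" by (metis det_mul)
  then have "det M * det C * det M * det A > det B * det A"
    using \<open>det B < det (B + P)\<close> pos_def_det_pos[OF assms(1)] by simp
  moreover have "det C * det A = 1" using C(2) by (metis det_mul det_I)
  then have "det M * det C * det M * det A = (det M)\<^sup>2"
    by (simp add: power2_eq_square ac_simps)
  ultimately show ?thesis by (simp add: M_def mult.commute)
qed

text \<open>A crude bound from the Leibniz formula. Coercivity only requires that \<open>det\<close>
  grows at most polynomially in the norm.\<close>

lemma abs_det_le: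
  fixes A :: "real^'n::finite^'n"
  shows "\<bar>det A\<bar> \<le> fact CARD('n) * norm A ^ CARD('n)"
proof -
  have entry: "\<bar>A $ i $ j\<bar> \<le> norm A" for i j
    by (meson component_le_norm_cart Finite_Cartesian_Product.norm_nth_le order_trans)
  have "\<bar>det A\<bar> \<le> (\<Sum>p | p permutes (UNIV :: 'n set).
      \<bar>of_int (sign p) * (\<Prod>i\<in>UNIV. A $ i $ p i)\<bar>)"
    unfolding det_def by (rule sum_abs)
  also have "\<dots> \<le> (\<Sum>p | p permutes (UNIV :: 'n set). norm A ^ CARD('n))"
  proof (rule sum_mono)
    fix p :: "'n \<Rightarrow> 'n"
    have "(\<Prod>i\<in>UNIV. \<bar>A $ i $ p i\<bar>) \<le> (\<Prod>i\<in>(UNIV :: 'n set). norm A)"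
      by (rule prod_mono) (use entry in auto)
    then show "\<bar>of_int (sign p) * (\<Prod>i\<in>UNIV. A $ i $ p i)\<bar> \<le> norm A ^ CARD('n)"
      by (simp add: abs_mult abs_prod sign_def)
  qed
  also have "\<dots> = fact CARD('n) * norm A ^ CARD('n)"
    by (simp add: card_permutations)
  finally show ?thesis .
qed

section \<open>Minimizers of the two objectives\<close>

lemma S_graph_add: "V \<in> S_graph E \<Longrightarrow> W \<in> S_graph E \<Longrightarrow> V + W \<in> S_graph E"
  by (simp add: S_graph_def symmetric_mat_nth)

lemma S_graph_scaleR: "W \<in> S_graph E \<Longrightarrow> c *\<^sub>R W \<in> S_graph E"
  by (simp add: S_graph_def symmetric_mat_nth)

text \<open>\<open>A\<close> annihilates every column of \<open>D\<close>, so adding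
  \<open>D\<close> to the minimizer leaves the quadratic part unchanged, while the logarithmic part
  cannot get worse. Hence \<open>W + D\<close> is a minimizer too.\<close>

lemma concord_unique_minimizer_imp:
  assumes "psd A" "has_unique_minimizer (concord A) (D_graph E)"
    and "D \<in> S_graph E" "\<And>i. 0 \<le> D $ i $ i" "A ** D = 0"
  shows "D = 0"
proof -
  obtain W where W: "is_arg_min (concord A) (\<lambda>y. y \<in> D_graph E) W"
    and uniq: "\<And>V. is_arg_min (concord A) (\<lambda>y. y \<in> D_graph E) V \<Longrightarrow> V = W"
    using assms(2) unfolding has_unique_minimizer_def by blast
  have W_in: "W \<in> S_graph E" "\<And>i. 0 < W $ i $ i"
    using W by (auto simp: is_arg_min_def D_graph_def)
  have WD: "W + D \<in> D_graph E"
    using W_in assms(3,4) S_graph_add by (auto simp: D_graph_def intro: add_pos_nonneg)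
  have col: "column i (W + D) \<bullet> (A *v column i (W + D)) = column i W \<bullet> (A *v column i W)" for i
  proof -
    have "A *v column i D = (A ** D) *v axis i 1"
      by (metis matrix_vector_mul_assoc matrix_vector_mult_basis)
    then have AD: "A *v column i D = 0" using assms(5) by simp
    \<comment> \<open>Symmetry moves \<open>A\<close> to the column of \<open>D\<close>, which it
      annihilates.\<close>
    have "column i D \<bullet> (A *v column i W) = 0"
      using symmetric_mat_inner[of A "column i D" "column i W"] assms(1) AD by (simp add: psd_def)
    moreover have "column i (W + D) = column i W + column i D"
      by (simp add: column_def vec_eq_iff)
    ultimately show ?thesis
      using AD by (simp add: matrix_vector_right_distrib inner_add_left)
  qed
  have "(\<Sum>i\<in>UNIV. ln (W $ i $ i)) \<le> (\<Sum>i\<in>UNIV. ln ((W + D) $ i $ i))"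
    by (rule sum_mono) (use W_in(2) assms(4) in \<open>simp add: add_pos_nonneg\<close>)
  then have "concord A (W + D) \<le> concord A W"
    unfolding concord_def col by simp
  then have "is_arg_min (concord A) (\<lambda>y. y \<in> D_graph E) (W + D)"
    using W WD unfolding is_arg_min_def by (meson le_less_trans less_le_trans not_le)
  then have "W + D = W" by (rule uniq)
  then show ?thesis by simp
qed

section \<open>Compactness, and existence and uniqueness of the Gaussian minimizer\<close>

lemma closed_symmetric_mat: "closed {W :: real^'n^'n. symmetric_mat W}"
  unfolding symmetric_mat_nth
  by (intro closed_Collect_all closed_Collect_eq continuous_intros)

lemma closed_psd_S_graph: "closed {W \<in> S_graph E. psd W}"
proof -
  have "{W \<in> S_graph E. psd W} =
      {W. symmetric_mat W} \<inter> {W. \<forall>x. 0 \<le> x \<bullet> (W *v x)}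
        \<inter> {W. \<forall>i j. i \<noteq> j \<and> {i, j} \<notin> E \<longrightarrow> W $ i $ j = 0}"
    by (auto simp: S_graph_def psd_def)
  moreover have "closed {W :: real^'a^'a. \<forall>x. 0 \<le> x \<bullet> (W *v x)}"
    unfolding matrix_vector_mult_def inner_vec_def
    by (intro closed_Collect_all closed_Collect_le continuous_intros)
  moreover have "closed {W :: real^'a^'a. \<forall>i j. i \<noteq> j \<and> {i, j} \<notin> E \<longrightarrow> W $ i $ j = 0}"
    by (intro closed_Collect_all closed_Collect_imp closed_Collect_eq open_Collect_const
        continuous_intros)
  ultimately show ?thesis using closed_symmetric_mat by (auto intro!: closed_Int)
qed

lemma continuous_on_trace_mult: "continuous_on S (\<lambda>W :: real^'n^'n. trace (A ** W))"
  unfolding trace_def matrix_matrix_mult_def by (simp, intro continuous_intros)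

lemma trace_mult_scaleR: "trace (A ** (c *\<^sub>R W)) = c * trace (A ** W)"
  for A W :: "real^'n^'n"
  by (simp add: trace_def matrix_matrix_mult_def sum_distrib_left ac_simps)

text \<open>The constant is the minimum of the trace over the compact unit sphere of the cone. It is
  positive, since a zero trace would force \<open>A ** M = 0\<close>. Homogeneity extends the bound
  to the whole cone.\<close>

lemma trace_mult_lower_bound:
  fixes A :: "real^'n::finite^'n"
  assumes "psd A"
    and "\<And>D. D \<in> S_graph E \<Longrightarrow> psd D \<Longrightarrow> A ** D = 0 \<Longrightarrow> D = 0"
  obtains c where "0 < c" "\<And>W. W \<in> S_graph E \<Longrightarrow> psd W \<Longrightarrow> c * norm W \<le> trace (A ** W)"
proof -
  define K where "K = {W \<in> S_graph E. psd W} \<inter> sphere 0 1"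
  have "compact K"
    unfolding K_def by (intro closed_Int_compact closed_psd_S_graph compact_sphere)
  have in_K: "(1 / norm W) *\<^sub>R W \<in> K" if "W \<in> S_graph E" "psd W" "W \<noteq> 0" for W
    using that by (simp add: K_def S_graph_scaleR psd_scaleR)
  \<comment> \<open>The normalized identity shows that the slice \<open>K\<close> is nonempty, so
    the minimum is attained.\<close>
  have "mat 1 \<in> S_graph E"
    by (simp add: S_graph_def symmetric_mat_def mat_def transpose_def vec_eq_iff)
  moreover have "mat 1 \<noteq> (0 :: real^'n^'n)"
    by (metis det_I mat_0 det_0 zero_neq_one)
  ultimately have "K \<noteq> {}"
    using in_K pos_def_imp_psd pos_def_mat_1 by blast
  then obtain M where M: "M \<in> K" "\<And>W. W \<in> K \<Longrightarrow> trace (A ** M) \<le> trace (A ** W)"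
    using continuous_attains_inf[OF \<open>compact K\<close> _ continuous_on_trace_mult] by blast
  show thesis
  proof
    have "M \<noteq> 0" using M(1) by (auto simp: K_def)
    then show "0 < trace (A ** M)"
      using M(1) assms trace_mult_psd[of A M] trace_mult_psd_eq_0[of A M]
      by (auto simp: K_def less_le)
    fix W assume W: "W \<in> S_graph E" "psd W"
    show "trace (A ** M) * norm W \<le> trace (A ** W)"
    proof (cases "W = 0")
      case True
      then show ?thesis using trace_mult_psd[OF assms(1) W(2)] by simp
    next
      case False
      then have "trace (A ** M) \<le> trace (A ** W) / norm W"
        using M(2)[OF in_K[OF W False]] by (simp add: trace_mult_scaleR)
      then show ?thesis using False by (simp add: field_simps)
    qed
  qed
qed

text \<open>The trace grows at least linearly in the norm, \<open>ln (det W)\<close> at most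
  logarithmically.\<close>

lemma gaussian_coercive:
  fixes A :: "real^'n::finite^'n"
  assumes "psd A"
    and "\<And>D. D \<in> S_graph E \<Longrightarrow> psd D \<Longrightarrow> A ** D = 0 \<Longrightarrow> D = 0"
  obtains R where "\<And>W. W \<in> P_graph E \<Longrightarrow> gaussian A W \<le> b \<Longrightarrow> norm W \<le> R"
proof -
  obtain c where c: "0 < c" "\<And>W. W \<in> S_graph E \<Longrightarrow> psd W \<Longrightarrow> c * norm W \<le> trace (A ** W)"
    using trace_mult_lower_bound[OF assms] by blast
  \<comment> \<open>The scale \<open>a\<close> makes \<open>p * (norm W / a)\<close> equal to
    \<open>c / 2 * norm W\<close>, so the logarithm uses up only half of the linear bound.\<close>
  define p F a where "p = real CARD('n)" and "F = ln (fact CARD('n) :: real)" and "a = 2 * p / c"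
  have a: "0 < a" "0 < p" using c by (simp_all add: a_def p_def)
  show thesis
  proof
    fix W assume W: "W \<in> P_graph E" "gaussian A W \<le> b"
    then have pd: "pos_def W" "W \<in> S_graph E" by (auto simp: P_graph_def)
    have det: "0 < det W" using pos_def_det_pos pd by blast
    have n: "0 < norm W"
      using pos_def_det_nonzero[OF pd(1)] by (metis mat_0 det_0 zero_less_norm_iff)
    have "ln (det W) \<le> ln (fact CARD('n) * norm W ^ CARD('n))"
      using abs_det_le[of W] det n by simp
    also have "\<dots> = F + p * ln (norm W)"
      using n by (simp add: F_def p_def ln_mult ln_realpow)
    also have "ln (norm W) = ln (norm W / a) + ln a"
      using n a by (simp add: ln_div)
    also have "ln (norm W / a) \<le> norm W / a"
      using n a ln_le_minus_one[of "norm W / a"] by simp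
    finally have "ln (det W) \<le> F + p * (norm W / a + ln a)"
      using a(2) by simp
    also have "\<dots> = F + c / 2 * norm W + p * ln a"
      using a c by (simp add: a_def field_simps)
    finally have "c * norm W \<le> b + F + c / 2 * norm W + p * ln a"
      using W(2) c(2)[OF pd(2) pos_def_imp_psd[OF pd(1)]] by (simp add: gaussian_def)
    then show "norm W \<le> 2 * (b + F + p * ln a) / c"
      using c(1) by (simp add: field_simps)
  qed
qed

text \<open>The positive definite cone is not closed, so the search is confined to a compact
  \<open>K\<close> that contains the sublevel set of the identity. There the determinant stays away
  from 0, which keeps \<open>K\<close> inside the cone and the objective continuous.\<close>

lemma gaussian_minimizer_exists:
  fixes A :: "real^'n::finite^'n"
  assumes "psd A"
    and "\<And>D. D \<in> S_graph E \<Longrightarrow> psd D \<Longrightarrow> A ** D = 0 \<Longrightarrow> D = 0"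
  shows "\<exists>W. is_arg_min (gaussian A) (\<lambda>W. W \<in> P_graph E) W"
proof -
  define b where "b = gaussian A (mat 1)"
  obtain R where R: "\<And>W. W \<in> P_graph E \<Longrightarrow> gaussian A W \<le> b \<Longrightarrow> norm W \<le> R"
    using gaussian_coercive[OF assms] by blast
  define K where "K = ({W \<in> S_graph E. psd W} \<inter> {W. exp (- b) \<le> det W}) \<inter> cball 0 R"
  have "closed {W :: real^'n^'n. exp (- b) \<le> det W}"
    by (intro closed_Collect_le continuous_on_det continuous_intros)
  then have "compact K"
    unfolding K_def by (intro closed_Int_compact closed_Int closed_psd_S_graph) auto
  have K_P: "K \<subseteq> P_graph E"
  proof
    fix W assume "W \<in> K"
    moreover then have "0 < det W" unfolding K_def using exp_gt_zero less_le_trans by blast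
    ultimately show "W \<in> P_graph E"
      using psd_det_nonzero_imp_pos_def[of W] by (simp add: K_def P_graph_def)
  qed
  have sublevel: "W \<in> K" if W: "W \<in> P_graph E" "gaussian A W \<le> b" for W
  proof -
    have pd: "pos_def W" "W \<in> S_graph E" using W by (auto simp: P_graph_def)
    have "0 < det W" using pos_def_det_pos pd by blast
    \<comment> \<open>The trace term is nonnegative, so a value of at most \<open>b\<close> bounds
      \<open>- ln (det W)\<close> by \<open>b\<close>.\<close>
    moreover have "- b \<le> ln (det W)"
      using W(2) trace_mult_psd[OF assms(1) pos_def_imp_psd[OF pd(1)]]
      by (simp add: gaussian_def)
    ultimately have "exp (- b) \<le> det W" by (metis exp_le_cancel_iff exp_ln)
    then show ?thesis using pd pos_def_imp_psd R[OF W] by (simp add: K_def)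
  qed
  have "mat 1 \<in> P_graph E"
    using pos_def_mat_1 by (auto simp: P_graph_def S_graph_def pos_def_def mat_def)
  then have "mat 1 \<in> K" using sublevel by (simp add: b_def)
  have "continuous_on K (gaussian A)"
    unfolding gaussian_def
    using K_P pos_def_det_nonzero
    by (intro continuous_intros continuous_on_det continuous_on_trace_mult)
      (auto simp: P_graph_def)
  then obtain M where M: "M \<in> K" "\<And>W. W \<in> K \<Longrightarrow> gaussian A M \<le> gaussian A W"
    using continuous_attains_inf[OF \<open>compact K\<close>] \<open>mat 1 \<in> K\<close> by blast
  have "gaussian A M \<le> gaussian A W" if "W \<in> P_graph E" for W
  proof (cases "gaussian A W \<le> b")
    case True
    then show ?thesis using M sublevel that by blast
  next
    case False
    then show ?thesis using M(2)[OF \<open>mat 1 \<in> K\<close>] by (simp add: b_def)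
  qed
  then show ?thesis using M(1) K_P unfolding is_arg_min_def by (meson not_le subsetD)
qed

text \<open>At the midpoint of two distinct minimizers the trace is the average, but
  \<open>ln det\<close> exceeds the average, so the objective would be strictly smaller
  there.\<close>

lemma gaussian_minimizer_unique:
  assumes "is_arg_min (gaussian A) (\<lambda>W. W \<in> P_graph E) V"
    and "is_arg_min (gaussian A) (\<lambda>W. W \<in> P_graph E) W"
  shows "V = W"
proof (rule ccontr)
  assume neq: "V \<noteq> W"
  define M where "M = (1/2) *\<^sub>R (V + W)"
  have V: "V \<in> S_graph E" "pos_def V" and W: "W \<in> S_graph E" "pos_def W"
    using assms by (auto simp: is_arg_min_def P_graph_def)
  have M: "pos_def M"
    unfolding M_def by (intro pos_def_scaleR pos_def_add_psd pos_def_imp_psd V W) simp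
  have "M \<in> P_graph E"
    using M V W unfolding M_def P_graph_def by (simp add: S_graph_add S_graph_scaleR)
  then have "gaussian A V \<le> gaussian A M" "gaussian A W \<le> gaussian A M"
    using assms by (auto simp: is_arg_min_def not_less)
  moreover have "2 * trace (A ** M) = trace (A ** V) + trace (A ** W)"
    by (simp add: M_def trace_mult_scaleR matrix_add_ldistrib trace_add)
  moreover have "ln (det V) + ln (det W) < 2 * ln (det M)"
  proof -
    note pos = pos_def_det_pos[OF V(2)] pos_def_det_pos[OF W(2)] pos_def_det_pos[OF M]
    have "ln (det V * det W) < ln ((det M)\<^sup>2)"
      using det_midpoint[OF V(2) W(2) neq] pos by (simp add: M_def)
    then show ?thesis using pos by (simp add: ln_mult ln_realpow)
  qed
  ultimately show False by (simp add: gaussian_def)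
qed

text \<open>A positive semidefinite \<open>D\<close> has a nonnegative diagonal, so uniqueness for
  CONCORD rules out the directions that would spoil coercivity.\<close>

lemma concord_imp_gaussian_unique_minimizer:
  fixes A :: "real^'n::finite^'n"
  assumes "psd A" "has_unique_minimizer (concord A) (D_graph E)"
  shows "has_unique_minimizer (gaussian A) (P_graph E)"
proof -
  have "D = 0" if "D \<in> S_graph E" "psd D" "A ** D = 0" for D
    using concord_unique_minimizer_imp[OF assms that(1) psd_diag_nonneg[OF that(2)] that(3)] .
  then show ?thesis
    using gaussian_minimizer_exists[OF assms(1)] gaussian_minimizer_unique
    unfolding has_unique_minimizer_def by metis
qed

section \<open>From single matrices to the ranks\<close>

lemma psd_gram: "psd (gram r X :: real^'n::finite^'n)"
proof (induction r)
  case 0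
  then show ?case by (simp add: gram_def psd_def symmetric_mat_nth matrix_vector_mult_def
        inner_vec_def)
next
  case (Suc r)
  have "gram (Suc r) X = gram r X + outer (\<chi> i. X (r, i))"
    by (simp add: gram_def outer_def vec_eq_iff)
  then show ?case using Suc psd_add psd_outer by metis
qed

text \<open>Since the implication holds matrix by matrix, each pseudo-likelihood rank also meets the
  condition defining the matching Gaussian rank, which is the least such number.\<close>

theorem theorem2:
  fixes E :: "'n::finite set set"
  assumes "simple_graph E"
  shows "weak_gaussian_rank E \<le> weak_pl_rank E \<and> strong_gaussian_rank E \<le> strong_pl_rank E"
proof
  have pl: "almost_every_psd (weak_pl_rank E) (\<lambda>A. has_unique_minimizer (concord A) (D_graph E))"
    \<comment> \<open>\<open>LeastI\<close> asks for one admissible number;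
      \<open>Suc CARD('n)\<close> is one, as it leaves no \<open>r\<close> to check.\<close>
    unfolding weak_pl_rank_def by (rule LeastI) (rule almost_every_psd_vacuous)
  have "almost_every_psd (weak_pl_rank E) (\<lambda>A. has_unique_minimizer (gaussian A) (P_graph E))"
    unfolding almost_every_psd_def
  proof
    fix r assume "r \<in> {weak_pl_rank E..CARD('n)}"
    with pl have "AE X in lebesgue_rect r. has_unique_minimizer (concord (gram r X)) (D_graph E)"
      unfolding almost_every_psd_def by (rule bspec)
    then show "AE X in lebesgue_rect r. has_unique_minimizer (gaussian (gram r X)) (P_graph E)"
      by (rule eventually_mono) (rule concord_imp_gaussian_unique_minimizer[OF psd_gram])
  qed
  then show "weak_gaussian_rank E \<le> weak_pl_rank E"
    unfolding weak_gaussian_rank_def by (rule Least_le)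
  have "every_general_psd (strong_pl_rank E) (\<lambda>A. has_unique_minimizer (concord A) (D_graph E))"
    unfolding strong_pl_rank_def by (rule LeastI) (rule every_general_psd_vacuous)
  then have "every_general_psd (strong_pl_rank E) (\<lambda>A. has_unique_minimizer (gaussian A) (P_graph E))"
    unfolding every_general_psd_def by (blast intro: concord_imp_gaussian_unique_minimizer)
  then show "strong_gaussian_rank E \<le> strong_pl_rank E"
    unfolding strong_gaussian_rank_def by (rule Least_le)
qed

end
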